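(* Consider the Gaussian sequence model $X_i\sim\mathcal N(\theta_i,1)$, $i=1,\dots,n$, independent, with parameter space $\Theta(s)$ and sparsity $0<s\le\sqrt n/2$. Given an estimator $\widehat\theta$ and a real number $\gamma$ such that $4\gamma+1/\log(n/s^2)\le0.99$ and $$\sup_{\theta\in\Theta(s)}\big\|E_\theta[\widehat\theta]-\theta\big\|_2^2\le\gamma s\log\Big(\frac n{s^2}\Big),$$ then, for all sufficiently large $n$, $$\sum_{i=1}^n\mathrm{Var}_0(\widehat\theta_i)\ \ge\ \frac{1-(1/2)^{0.01}}{25\,e\,\log(n/s^2)}\;n\Big(\frac{s^2}{n}\Big)^{4\gamma},$$ where $\mathrm{Var}_0$ denotes the variance for parameter vector $\theta=(0,\dots,0)^\top$.
   Context: $\Theta(s)$ is the set of all vectors $\theta=(\theta_1,\dots,\theta_n)\in\mathbb R^n$ with at most $s$ non-zero components. An estimator $\widehat\theta=(\widehat\theta_1,\dots,\widehat\theta_n)$ is a function of $X=(X_1,\dots,X_n)$ with values in $\mathbb R^n$ (not required to be sparse) such that $E_\theta[\widehat\theta]$ exists and is finite for all $\theta$ in the parameter space. The variance of a non-square-integrable variable is $+\infty$. $E_\theta$ is the expectation under parameter $\theta$, and $\|\cdot\|_2$ is the Euclidean norm. *)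

theory Defs
  imports "HOL-Probability.Probability"
begin

text \<open>
  Vectors in \<open>\<real>\<^sup>n\<close> are the elements of \<open>{1..n} \<rightarrow>\<^sub>E UNIV\<close>, i.e. functions on \<open>nat\<close> that are
  \<open>undefined\<close> outside \<open>{1..n}\<close>, so that \<open>n\<close> can be quantified over; the Euclidean norm is
  then \<open>\<lambda>v. L2_set v {1..n}\<close>.
\<close>

definition sparse_vectors :: "nat \<Rightarrow> nat \<Rightarrow> (nat \<Rightarrow> real) set" where
  "sparse_vectors n s =
     {\<theta> \<in> {1..n} \<rightarrow>\<^sub>E (UNIV :: real set). card {i \<in> {1..n}. \<theta> i \<noteq> 0} \<le> s}"

definition zero_vector :: "nat \<Rightarrow> nat \<Rightarrow> real" where
  "zero_vector n = (\<lambda>i\<in>{1..n}. 0)"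

text \<open>
  The law of the observation \<open>X\<close>: independent coordinates \<open>X\<^sub>i \<sim> N(\<theta>\<^sub>i, 1)\<close>. An estimator is a
  function of \<open>X\<close>, so all its moments are taken under this law on \<open>\<real>\<^sup>n\<close>.
\<close>

definition gaussian_seq :: "nat \<Rightarrow> (nat \<Rightarrow> real) \<Rightarrow> (nat \<Rightarrow> real) measure" where
  "gaussian_seq n \<theta> = (\<Pi>\<^sub>M i\<in>{1..n}. density lborel (normal_density (\<theta> i) 1))"

definition is_estimator :: "nat \<Rightarrow> nat \<Rightarrow> ((nat \<Rightarrow> real) \<Rightarrow> nat \<Rightarrow> real) \<Rightarrow> bool" where
  "is_estimator n s T \<longleftrightarrow>
     T \<in> (\<Pi>\<^sub>M i\<in>{1..n}. (borel :: real measure)) \<rightarrow>\<^sub>M (\<Pi>\<^sub>M i\<in>{1..n}. (borel :: real measure)) \<and>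
     (\<forall>\<theta>\<in>sparse_vectors n s. \<forall>i\<in>{1..n}. integrable (gaussian_seq n \<theta>) (\<lambda>x. T x i))"

definition mean_vector :: "nat \<Rightarrow> (nat \<Rightarrow> real) \<Rightarrow> ((nat \<Rightarrow> real) \<Rightarrow> nat \<Rightarrow> real) \<Rightarrow> nat \<Rightarrow> real" where
  "mean_vector n \<theta> T = (\<lambda>i\<in>{1..n}. integral\<^sup>L (gaussian_seq n \<theta>) (\<lambda>x. T x i))"

text \<open>
  Bochner integrals of non-integrable functions are \<open>0\<close>, so the convention that a variable which
  is not square-integrable has variance \<open>+\<infinity>\<close> is imposed explicitly.
\<close>

definition ext_variance :: "'a measure \<Rightarrow> ('a \<Rightarrow> real) \<Rightarrow> ereal" where
  "ext_variance M f =
     (if integrable M (\<lambda>x. (f x)\<^sup>2) then ereal (prob_space.variance M f) else \<infinity>)"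

end

theory Submission
  imports Defs
begin

text \<open>
  Split the coordinates into \<open>s\<close> blocks of size \<open>m = n div s\<close> and activate one coordinate per
  block, with signal strength \<open>a\<close>, where \<open>a\<^sup>2 = (4 \<gamma> + 1 / L) L\<close> and \<open>L = ln (n / s\<^sup>2)\<close>. For a
  given coordinate, compare the mean of the estimator under the null vector with its mean under
  the uniform mixture of all configurations in which this coordinate is active. By Cauchy--Schwarz
  the squared difference is at most the variance under the null times the second moment of the
  likelihood ratio of the mixture. The latter is an average of \<open>exp \<langle>\<theta>, \<theta>'\<rangle>\<close>; it factorizes over
  the blocks and is at most \<open>exp (1 + a\<^sup>2)\<close>. On the other hand the differences of means are \<open>a\<close>
  up to the bias, so Minkowski's inequality over all coordinates bounds their squared sum from
  below by a multiple of \<open>n\<close>.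
\<close>

section \<open>Densities of product measures and the Cauchy--Schwarz inequality\<close>

text \<open>A measure on a finite product of sigma-finite spaces is determined by its values on
  boxes. On a box the indicator splits over the coordinates, so the integral of the product is the
  product of the integrals.\<close>

lemma density_PiM:
  fixes f :: "'i \<Rightarrow> 'a \<Rightarrow> ennreal"
  assumes I: "finite I" and M: "product_sigma_finite M"
    and D: "product_sigma_finite (\<lambda>i. density (M i) (f i))"
    and f: "\<And>i. f i \<in> borel_measurable (M i)"
  shows "density (PiM I M) (\<lambda>x. \<Prod>i\<in>I. f i (x i)) = PiM I (\<lambda>i. density (M i) (f i))"
proof (rule product_sigma_finite.PiM_eqI[OF D I])
  interpret M: product_sigma_finite M by (rule M)
  note f[measurable]
  show "sets (density (PiM I M) (\<lambda>x. \<Prod>i\<in>I. f i (x i))) = sets (PiM I (\<lambda>i. density (M i) (f i)))"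
    by (simp cong: sets_PiM_cong)
  fix A assume "\<And>i. i \<in> I \<Longrightarrow> A i \<in> sets (density (M i) (f i))"
  then have A: "i \<in> I \<Longrightarrow> A i \<in> sets (M i)" for i by simp
  have *: "(\<Prod>i\<in>I. f i (x i)) * indicator (Pi\<^sub>E I A) x = (\<Prod>i\<in>I. f i (x i) * indicator (A i) (x i))"
    if "x \<in> space (PiM I M)" for x
  proof (cases "x \<in> Pi\<^sub>E I A")
    case True
    then show ?thesis by (auto simp: PiE_iff intro!: prod.cong)
  next
    case False
    with that obtain i where "i \<in> I" "x i \<notin> A i"
      by (auto simp: space_PiM PiE_iff)
    then have "(\<Prod>i\<in>I. f i (x i) * indicator (A i) (x i)) = 0"
      using I \<open>i \<in> I\<close> \<open>x i \<notin> A i\<close> by (intro prod_zero bexI[of _ i]) auto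
    with False show ?thesis by simp
  qed
  have "emeasure (density (PiM I M) (\<lambda>x. \<Prod>i\<in>I. f i (x i))) (Pi\<^sub>E I A)
      = (\<integral>\<^sup>+x. (\<Prod>i\<in>I. f i (x i)) * indicator (Pi\<^sub>E I A) x \<partial>PiM I M)"
    using A I by (intro emeasure_density) (auto intro!: sets_PiM_I_finite)
  also have "\<dots> = (\<integral>\<^sup>+x. (\<Prod>i\<in>I. f i (x i) * indicator (A i) (x i)) \<partial>PiM I M)"
    by (intro nn_integral_cong *)
  also have "\<dots> = (\<Prod>i\<in>I. \<integral>\<^sup>+x. f i x * indicator (A i) x \<partial>M i)"
    using A by (intro M.product_nn_integral_prod I) auto
  also have "\<dots> = (\<Prod>i\<in>I. emeasure (density (M i) (f i)) (A i))"
    using A by (intro prod.cong refl) (simp add: emeasure_density)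
  finally show "emeasure (density (PiM I M) (\<lambda>x. \<Prod>i\<in>I. f i (x i))) (Pi\<^sub>E I A)
      = (\<Prod>i\<in>I. emeasure (density (M i) (f i)) (A i))" .
qed

text \<open>The integral of \<open>(r * f - t * g)\<^sup>2\<close> is a nonnegative quadratic form
  in \<open>r\<close> and \<open>t\<close>; evaluating it at \<open>r = v\<close>,
  \<open>t = w\<close> gives \<open>v * (u * v - w\<^sup>2) \<ge> 0\<close>.\<close>

lemma integral_Cauchy_Schwarz:
  fixes f g :: "'a \<Rightarrow> real"
  assumes [measurable]: "f \<in> borel_measurable M" "g \<in> borel_measurable M"
    and f: "integrable M (\<lambda>x. (f x)\<^sup>2)" and g: "integrable M (\<lambda>x. (g x)\<^sup>2)"
  shows "integrable M (\<lambda>x. f x * g x)"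
    and "(\<integral>x. f x * g x \<partial>M)\<^sup>2 \<le> (\<integral>x. (f x)\<^sup>2 \<partial>M) * (\<integral>x. (g x)\<^sup>2 \<partial>M)"
proof -
  have "\<bar>f x * g x\<bar> \<le> (f x)\<^sup>2 + (g x)\<^sup>2" for x
    using sum_squares_bound[of "\<bar>f x\<bar>" "\<bar>g x\<bar>"] mult_nonneg_nonneg[of "\<bar>f x\<bar>" "\<bar>g x\<bar>"]
    unfolding abs_mult power2_abs mult.assoc by linarith
  then show fg: "integrable M (\<lambda>x. f x * g x)"
    by (intro Bochner_Integration.integrable_bound[OF Bochner_Integration.integrable_add[OF f g]])
      (auto intro!: AE_I2)
  define u v w where "u = (\<integral>x. (f x)\<^sup>2 \<partial>M)" and "v = (\<integral>x. (g x)\<^sup>2 \<partial>M)"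
    and "w = (\<integral>x. f x * g x \<partial>M)"
  have "0 \<le> (\<integral>x. (r * f x - t * g x)\<^sup>2 \<partial>M)" for r t by simp
  moreover have "(\<integral>x. (r * f x - t * g x)\<^sup>2 \<partial>M) = r\<^sup>2 * u - 2 * r * t * w + t\<^sup>2 * v" for r t
  proof -
    have "(\<integral>x. (r * f x - t * g x)\<^sup>2 \<partial>M)
        = (\<integral>x. r\<^sup>2 * (f x)\<^sup>2 - (2 * r * t) * (f x * g x) + t\<^sup>2 * (g x)\<^sup>2 \<partial>M)"
      by (intro Bochner_Integration.integral_cong) (auto simp: power2_eq_square algebra_simps)
    also have "\<dots> = r\<^sup>2 * u - 2 * r * t * w + t\<^sup>2 * v"
      using f g fg by (simp add: u_def v_def w_def)
    finally show ?thesis .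
  qed
  ultimately have q: "0 \<le> r\<^sup>2 * u - 2 * r * t * w + t\<^sup>2 * v" for r t by simp
  have "u \<ge> 0" "v \<ge> 0" by (auto simp: u_def v_def)
  have "w\<^sup>2 \<le> u * v"
  proof (cases "v = 0")
    case True
    have "w = 0"
    proof (rule ccontr)
      assume "w \<noteq> 0"
      \<comment> \<open>When \<open>v = 0\<close> the form is affine in \<open>t\<close>, and this
        \<open>t\<close> makes it equal to \<open>-1\<close>.\<close>
      then show False using q[of 1 "(u + 1) / (2 * w)"] True by simp
    qed
    then show ?thesis using True by simp
  next
    case False
    then have "0 \<le> v * (u * v - w\<^sup>2)"
      using q[of v w] by (simp add: power2_eq_square algebra_simps)
    then show ?thesis using False \<open>v \<ge> 0\<close> by (simp add: zero_le_mult_iff)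
  qed
  then show "(\<integral>x. f x * g x \<partial>M)\<^sup>2 \<le> (\<integral>x. (f x)\<^sup>2 \<partial>M) * (\<integral>x. (g x)\<^sup>2 \<partial>M)"
    by (simp add: u_def v_def w_def)
qed

section \<open>Likelihood ratios in the Gaussian sequence model\<close>

text \<open>An explicit formula makes products of two ratios computable. Only the coordinates in
  \<open>{1..n}\<close> enter, so pointwise sums of parameters are admissible arguments although
  they need not be extensional.\<close>

definition likelihood_ratio :: "nat \<Rightarrow> (nat \<Rightarrow> real) \<Rightarrow> (nat \<Rightarrow> real) \<Rightarrow> real" where
  "likelihood_ratio n \<theta> x = (\<Prod>i\<in>{1..n}. exp (\<theta> i * x i - (\<theta> i)\<^sup>2 / 2))"

lemma prob_space_gaussian_seq: "prob_space (gaussian_seq n \<theta>)"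
  unfolding gaussian_seq_def by (intro prob_space_PiM prob_space_normal_density) simp

lemma sets_gaussian_seq [measurable_cong]:
  "sets (gaussian_seq n \<theta>) = sets (\<Pi>\<^sub>M i\<in>{1..n}. (borel :: real measure))"
  unfolding gaussian_seq_def by (intro sets_PiM_cong) auto

lemma likelihood_ratio_measurable [measurable]:
  "likelihood_ratio n \<theta> \<in> borel_measurable (gaussian_seq n \<theta>')"
  unfolding likelihood_ratio_def by measurable

lemma likelihood_ratio_nonneg [simp]: "likelihood_ratio n \<theta> x \<ge> 0"
  unfolding likelihood_ratio_def by (simp add: prod_nonneg)

lemma normal_density_shift:
  "normal_density 0 1 x * exp (t * x - t\<^sup>2 / 2) = normal_density t 1 x"
proof -
  have "- (x\<^sup>2 / 2) + (t * x - t\<^sup>2 / 2) = - ((x - t)\<^sup>2 / 2)"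
    by (simp add: power2_eq_square field_simps)
  then show ?thesis
    by (simp add: normal_density_def exp_add [symmetric])
qed

text \<open>In one coordinate, completing the square turns the tilted standard normal density into
  the shifted one; \<open>density_PiM\<close> carries this over to the product.\<close>

lemma gaussian_seq_eq_density:
  "gaussian_seq n \<theta> = density (gaussian_seq n (zero_vector n)) (likelihood_ratio n \<theta>)"
proof -
  define f where "f i x = ennreal (exp (\<theta> i * x - (\<theta> i)\<^sup>2 / 2))" for i x
  let ?M = "\<lambda>i::nat. density lborel (normal_density 0 1)"
  have f [measurable]: "f i \<in> borel_measurable borel" for i
    unfolding f_def by measurable
  have D: "density (?M i) (f i) = density lborel (normal_density (\<theta> i) 1)" for i
    by (subst density_density_eq)
      (auto simp: f_def ennreal_mult'[symmetric] normal_density_shift)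
  have psf: "product_sigma_finite (\<lambda>i. density lborel (normal_density (\<mu> i) 1))" for \<mu> :: "nat \<Rightarrow> real"
    by unfold_locales (rule prob_space_imp_sigma_finite[THEN sigma_finite_measure.sigma_finite_countable, OF prob_space_normal_density], simp)
  have "gaussian_seq n \<theta> = PiM {1..n} (\<lambda>i. density (?M i) (f i))"
    by (simp add: D gaussian_seq_def)
  also have "\<dots> = density (PiM {1..n} ?M) (\<lambda>x. \<Prod>i\<in>{1..n}. f i (x i))"
    by (intro density_PiM[symmetric]) (auto simp: D psf)
  also have "PiM {1..n} ?M = gaussian_seq n (zero_vector n)"
    unfolding gaussian_seq_def by (intro PiM_cong) (auto simp: zero_vector_def)
  also have "(\<lambda>x. \<Prod>i\<in>{1..n}. f i (x i)) = likelihood_ratio n \<theta>"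
    by (auto simp: f_def likelihood_ratio_def prod_ennreal)
  finally show ?thesis .
qed

lemma integral_gaussian_seq:
  fixes f :: "(nat \<Rightarrow> real) \<Rightarrow> real"
  assumes "f \<in> borel_measurable (gaussian_seq n (zero_vector n))"
  shows "integral\<^sup>L (gaussian_seq n \<theta>) f
      = integral\<^sup>L (gaussian_seq n (zero_vector n)) (\<lambda>x. likelihood_ratio n \<theta> x * f x)"
    and "integrable (gaussian_seq n \<theta>) f
      \<longleftrightarrow> integrable (gaussian_seq n (zero_vector n)) (\<lambda>x. likelihood_ratio n \<theta> x * f x)"
  using assms by (subst gaussian_seq_eq_density; simp add: integral_density integrable_density)+

lemma likelihood_ratio_expectation:
  "integrable (gaussian_seq n (zero_vector n)) (likelihood_ratio n \<theta>)"
  "integral\<^sup>L (gaussian_seq n (zero_vector n)) (likelihood_ratio n \<theta>) = 1"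
proof -
  interpret prob_space "gaussian_seq n \<theta>" by (rule prob_space_gaussian_seq)
  show "integrable (gaussian_seq n (zero_vector n)) (likelihood_ratio n \<theta>)"
    using integral_gaussian_seq(2)[of "\<lambda>_. 1" n \<theta>] by simp
  show "integral\<^sup>L (gaussian_seq n (zero_vector n)) (likelihood_ratio n \<theta>) = 1"
    using integral_gaussian_seq(1)[of "\<lambda>_. 1" n \<theta>] by (simp add: prob_space)
qed

text \<open>Tilting by two parameters amounts to tilting by their sum, up to the cross term of the
  square. As every likelihood ratio has mean one under the null, the mean of the product is
  \<open>exp\<close> of the inner product.\<close>

lemma likelihood_ratio_mult:
  "likelihood_ratio n \<theta> x * likelihood_ratio n \<theta>' x
    = exp (\<Sum>i=1..n. \<theta> i * \<theta>' i) * likelihood_ratio n (\<lambda>i. \<theta> i + \<theta>' i) x"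
proof -
  have "(\<theta> i * x i - (\<theta> i)\<^sup>2 / 2) + (\<theta>' i * x i - (\<theta>' i)\<^sup>2 / 2)
      = \<theta> i * \<theta>' i + ((\<theta> i + \<theta>' i) * x i - (\<theta> i + \<theta>' i)\<^sup>2 / 2)" for i
    by (simp add: power2_eq_square field_simps)
  then show ?thesis
    unfolding likelihood_ratio_def
    by (simp add: exp_sum prod.distrib[symmetric] exp_add[symmetric])
qed

lemma likelihood_ratio_mult_expectation:
  "integrable (gaussian_seq n (zero_vector n)) (\<lambda>x. likelihood_ratio n \<theta> x * likelihood_ratio n \<theta>' x)"
  "(\<integral>x. likelihood_ratio n \<theta> x * likelihood_ratio n \<theta>' x \<partial>gaussian_seq n (zero_vector n))
    = exp (\<Sum>i=1..n. \<theta> i * \<theta>' i)"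
  by (simp_all add: likelihood_ratio_mult likelihood_ratio_expectation)

text \<open>With \<open>Z\<close> the estimator centred at its null mean and \<open>W\<close> the
  likelihood ratio of the uniform mixture, the difference of means is the null expectation of
  \<open>Z * W\<close>, to which Cauchy--Schwarz applies. The second factor is the second moment of
  \<open>W\<close>, an average of exponentials of inner products.\<close>

lemma mixture_variance_bound:
  fixes \<theta> :: "'b \<Rightarrow> nat \<Rightarrow> real"
  assumes F: "finite F" "F \<noteq> {}"
    and [measurable]: "T \<in> borel_measurable (\<Pi>\<^sub>M i\<in>{1..n}. (borel :: real measure))"
    and T2: "integrable (gaussian_seq n (zero_vector n)) (\<lambda>x. (T x)\<^sup>2)"
  shows "((\<Sum>f\<in>F. integral\<^sup>L (gaussian_seq n (\<theta> f)) T) / card F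
        - integral\<^sup>L (gaussian_seq n (zero_vector n)) T)\<^sup>2
      \<le> prob_space.variance (gaussian_seq n (zero_vector n)) T
        * ((\<Sum>f\<in>F. \<Sum>g\<in>F. exp (\<Sum>i=1..n. \<theta> f i * \<theta> g i)) / (card F)\<^sup>2)"
proof -
  let ?P = "gaussian_seq n (zero_vector n)"
  let ?w = "\<lambda>f. likelihood_ratio n (\<theta> f)"
  interpret prob_space ?P by (rule prob_space_gaussian_seq)
  have N: "real (card F) > 0" using F by (simp add: card_gt_0_iff)
  have [measurable]: "T \<in> borel_measurable ?P" by measurable
  have T1: "integrable ?P T" using T2 by (rule square_integrable_imp_integrable[rotated]) simp
  define Z where "Z x = T x - expectation T" for x
  have [measurable]: "Z \<in> borel_measurable ?P" unfolding Z_def by measurable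
  have Z2: "integrable ?P (\<lambda>x. (Z x)\<^sup>2)"
    unfolding Z_def power2_diff using T1 T2 by (auto intro!: Bochner_Integration.integrable_add Bochner_Integration.integrable_diff)
  define W where "W x = (\<Sum>f\<in>F. ?w f x) / card F" for x
  have [measurable]: "W \<in> borel_measurable ?P" unfolding W_def by measurable
  have W2: "(W x)\<^sup>2 = (\<Sum>f\<in>F. \<Sum>g\<in>F. ?w f x * ?w g x) / (card F)\<^sup>2" for x
    by (simp add: W_def power_divide power2_eq_square sum_product)
  have W2i: "integrable ?P (\<lambda>x. (W x)\<^sup>2)"
    unfolding W2 by (intro integrable_divide_zero Bochner_Integration.integrable_sum likelihood_ratio_mult_expectation)
  have W2e: "(\<integral>x. (W x)\<^sup>2 \<partial>?P) = (\<Sum>f\<in>F. \<Sum>g\<in>F. exp (\<Sum>i=1..n. \<theta> f i * \<theta> g i)) / (card F)\<^sup>2"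
    unfolding W2 by (simp add: likelihood_ratio_mult_expectation)
  \<comment> \<open>Both factors are square integrable under the null. Hence \<open>Z\<close>, and
    with it \<open>T\<close>, is integrable under every alternative, and its mean there can be
    split.\<close>
  have wZ: "integrable ?P (\<lambda>x. ?w f x * Z x)" for f
    using likelihood_ratio_mult_expectation(1)[of n "\<theta> f" "\<theta> f"]
    by (intro integral_Cauchy_Schwarz(1) Z2) (auto simp: power2_eq_square)
  have wZe: "(\<integral>x. ?w f x * Z x \<partial>?P) = integral\<^sup>L (gaussian_seq n (\<theta> f)) T - expectation T" for f
  proof -
    interpret f: prob_space "gaussian_seq n (\<theta> f)" by (rule prob_space_gaussian_seq)
    have "integrable (gaussian_seq n (\<theta> f)) Z"
      using wZ by (simp add: integral_gaussian_seq(2)[of _ _ "\<theta> f"])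
    then have "integrable (gaussian_seq n (\<theta> f)) (\<lambda>x. Z x + expectation T)" by simp
    then have "integrable (gaussian_seq n (\<theta> f)) T" by (simp add: Z_def)
    moreover have "(\<integral>x. ?w f x * Z x \<partial>?P) = integral\<^sup>L (gaussian_seq n (\<theta> f)) Z"
      by (subst integral_gaussian_seq(1)[of _ _ "\<theta> f"]) auto
    moreover have "integral\<^sup>L (gaussian_seq n (\<theta> f)) Z
        = integral\<^sup>L (gaussian_seq n (\<theta> f)) T - expectation T"
      using \<open>integrable (gaussian_seq n (\<theta> f)) T\<close> by (simp add: Z_def[abs_def] f.prob_space)
    ultimately show ?thesis by simp
  qed
  have "(\<integral>x. Z x * W x \<partial>?P) = (\<integral>x. (\<Sum>f\<in>F. ?w f x * Z x) / card F \<partial>?P)"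
    by (intro Bochner_Integration.integral_cong refl) (simp add: W_def sum_distrib_left mult.commute)
  also have "\<dots> = (\<Sum>f\<in>F. integral\<^sup>L (gaussian_seq n (\<theta> f)) T - expectation T) / card F"
    using wZ by (simp add: wZe)
  also have "\<dots> = (\<Sum>f\<in>F. integral\<^sup>L (gaussian_seq n (\<theta> f)) T) / card F - expectation T"
    using N by (simp add: sum_subtractf field_simps)
  finally have "(\<integral>x. Z x * W x \<partial>?P) = \<dots>" .
  then show ?thesis
    using integral_Cauchy_Schwarz(2)[OF _ _ Z2 W2i] by (simp add: W2e Z_def)
qed

section \<open>Block configurations and their combinatorics\<close>

text \<open>Blocks and positions count from \<open>0\<close>, coordinates from \<open>1\<close>; the
  inverse is division with remainder of \<open>i - 1\<close> by \<open>m\<close>.\<close>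

definition block_index :: "nat \<Rightarrow> nat \<Rightarrow> nat \<Rightarrow> nat" where
  "block_index m j k = Suc (j * m + k)"

definition block_choices :: "nat \<Rightarrow> nat \<Rightarrow> (nat \<Rightarrow> nat) set" where
  "block_choices s m = ({..<s} \<rightarrow>\<^sub>E {..<m})"

text \<open>The test \<open>(i - 1) div m < s\<close> keeps the coordinates left over after the last
  block at zero, where \<open>f\<close> would be evaluated outside its domain.\<close>

definition block_vector :: "nat \<Rightarrow> nat \<Rightarrow> nat \<Rightarrow> real \<Rightarrow> (nat \<Rightarrow> nat) \<Rightarrow> nat \<Rightarrow> real" where
  "block_vector n s m a f =
     (\<lambda>i\<in>{1..n}. if (i - 1) div m < s \<and> f ((i - 1) div m) = (i - 1) mod m then a else 0)"

lemma block_index_in: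
  assumes "s * m \<le> n" "j < s" "k < m"
  shows "block_index m j k \<in> {1..n}"
proof -
  have "j * m + k < Suc j * m" using assms by simp
  also have "\<dots> \<le> s * m" using assms by (intro mult_le_mono1) simp
  finally show ?thesis using assms by (simp add: block_index_def)
qed

lemma block_vector_block_index:
  assumes "s * m \<le> n" "j < s" "k < m"
  shows "block_vector n s m a f (block_index m j k) = (if f j = k then a else 0)"
  using block_index_in[OF assms] assms by (simp add: block_vector_def block_index_def)

lemma sum_block_index:
  fixes h :: "nat \<Rightarrow> 'a :: comm_monoid_add"
  assumes "s * m \<le> n" and m: "m > 0"
  shows "(\<Sum>j<s. \<Sum>k<m. h (block_index m j k)) = sum h {i \<in> {1..n}. (i - 1) div m < s}"
proof -
  have "(\<Sum>j<s. \<Sum>k<m. h (block_index m j k)) = (\<Sum>(j, k)\<in>{..<s}\<times>{..<m}. h (block_index m j k))"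
    by (simp add: sum.cartesian_product)
  also have "\<dots> = sum h {i \<in> {1..n}. (i - 1) div m < s}"
  proof (rule sum.reindex_bij_witness[of _ "\<lambda>i. ((i - 1) div m, (i - 1) mod m)" "\<lambda>(j, k). block_index m j k"])
    fix i assume "i \<in> {i \<in> {1..n}. (i - 1) div m < s}"
    with m show "((i - 1) div m, (i - 1) mod m) \<in> {..<s} \<times> {..<m}" by simp
  next
    fix p assume "p \<in> {..<s} \<times> {..<m}"
    then show "(case p of (j, k) \<Rightarrow> block_index m j k) \<in> {i \<in> {1..n}. (i - 1) div m < s}"
      using block_index_in[OF assms(1), of "fst p" "snd p"] by (auto simp: block_index_def)
  qed (auto simp: block_index_def)
  finally show ?thesis .
qed

lemma sum_block_index_le:
  fixes h :: "nat \<Rightarrow> real"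
  assumes "s * m \<le> n" "m > 0" "\<And>i. h i \<ge> 0"
  shows "(\<Sum>j<s. \<Sum>k<m. h (block_index m j k)) \<le> (\<Sum>i=1..n. h i)"
  unfolding sum_block_index[OF assms(1,2)] using assms(3) by (intro sum_mono2) auto

text \<open>Each of the \<open>s\<close> blocks contributes at most one nonzero coordinate.\<close>

lemma block_vector_sparse: "block_vector n s m a f \<in> sparse_vectors n s"
proof -
  have "{i \<in> {1..n}. block_vector n s m a f i \<noteq> 0} \<subseteq> (\<lambda>j. block_index m j (f j)) ` {..<s}"
  proof
    fix i assume "i \<in> {i \<in> {1..n}. block_vector n s m a f i \<noteq> 0}"
    then have i: "i \<ge> 1" "(i - 1) div m < s" "f ((i - 1) div m) = (i - 1) mod m"
      by (auto simp: block_vector_def split: if_splits)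
    then have "i = block_index m ((i - 1) div m) (f ((i - 1) div m))"
      by (simp add: block_index_def)
    then show "i \<in> (\<lambda>j. block_index m j (f j)) ` {..<s}" using i by blast
  qed
  then have "card {i \<in> {1..n}. block_vector n s m a f i \<noteq> 0} \<le> card {..<s}"
    by (rule surj_card_le[rotated]) simp
  then show ?thesis by (auto simp: sparse_vectors_def block_vector_def)
qed

text \<open>Two configurations overlap in a block only if they select the same position there. The
  exponential of the inner product is therefore a product over the blocks.\<close>

lemma block_vector_inner:
  assumes "s * m \<le> n" "m > 0" "f \<in> block_choices s m" "g \<in> block_choices s m"
  shows "(\<Sum>i=1..n. block_vector n s m a f i * block_vector n s m a g i)
    = (\<Sum>j<s. if f j = g j then a\<^sup>2 else 0)"
proof -
  let ?h = "\<lambda>i. block_vector n s m a f i * block_vector n s m a g i"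
  have "(\<Sum>i=1..n. ?h i) = sum ?h {i \<in> {1..n}. (i - 1) div m < s}"
    by (intro sum.mono_neutral_right) (auto simp: block_vector_def)
  also have "\<dots> = (\<Sum>j<s. \<Sum>k<m. ?h (block_index m j k))"
    by (rule sum_block_index[OF assms(1,2), symmetric])
  also have "\<dots> = (\<Sum>j<s. \<Sum>k<m. if k = f j then (if f j = g j then a\<^sup>2 else 0) else 0)"
    by (intro sum.cong refl) (auto simp: block_vector_block_index[OF assms(1)] power2_eq_square)
  also have "\<dots> = (\<Sum>j<s. if f j = g j then a\<^sup>2 else 0)"
    using assms(3) by (intro sum.cong refl) (auto simp: block_choices_def PiE_iff)
  finally show ?thesis .
qed

text \<open>Pinning one block leaves a product set, so counting and summation still factorize over
  the blocks.\<close>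

lemma block_choices_fixed:
  assumes "j < s" "k < m"
  shows "{f \<in> block_choices s m. f j = k} = (\<Pi>\<^sub>E i\<in>{..<s}. if i = j then {k} else {..<m})"
proof (intro set_eqI iffI)
  fix f assume "f \<in> {f \<in> block_choices s m. f j = k}"
  then have f: "f \<in> {..<s} \<rightarrow>\<^sub>E {..<m}" and "f j = k" by (simp_all add: block_choices_def)
  have "f i < m" if "i < s" for i using PiE_mem[OF f, of i] that by simp
  then show "f \<in> (\<Pi>\<^sub>E i\<in>{..<s}. if i = j then {k} else {..<m})"
    using \<open>f j = k\<close> by (intro PiE_I) (simp_all add: PiE_arb[OF f])
next
  fix f assume f: "f \<in> (\<Pi>\<^sub>E i\<in>{..<s}. if i = j then {k} else {..<m})"
  have "f j = k" using PiE_mem[OF f, of j] assms by simp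
  moreover have "f i < m" if "i < s" for i
    using PiE_mem[OF f, of i] assms that by (cases "i = j") auto
  then have "f \<in> block_choices s m"
    unfolding block_choices_def by (intro PiE_I) (simp_all add: PiE_arb[OF f])
  ultimately show "f \<in> {f \<in> block_choices s m. f j = k}" by simp
qed

lemma prod_if_eq_const:
  fixes u v :: "'a :: comm_monoid_mult"
  assumes "j < s"
  shows "(\<Prod>i<s. if i = j then u else v) = u * v ^ (s - 1)"
proof -
  have "(\<Prod>i<s. if i = j then u else v) = u * (\<Prod>i\<in>{..<s} - {j}. if i = j then u else v)"
    using assms by (subst prod.remove[of _ j]) auto
  also have "(\<Prod>i\<in>{..<s} - {j}. if i = j then u else v) = (\<Prod>i\<in>{..<s} - {j}. v)"
    by (intro prod.cong) auto
  finally show ?thesis using assms by simp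
qed

lemma card_block_choices_fixed:
  assumes "j < s" "k < m"
  shows "card {f \<in> block_choices s m. f j = k} = m ^ (s - 1)"
proof -
  have "card {f \<in> block_choices s m. f j = k} = (\<Prod>i<s. if i = j then 1 else m)"
    unfolding block_choices_fixed[OF assms] by (subst card_PiE) (auto intro!: prod.cong)
  then show ?thesis by (simp add: prod_if_eq_const[OF assms(1)])
qed

text \<open>For independent uniform \<open>f\<close> and \<open>g\<close> in \<open>G\<close>, block
  \<open>j\<close> always agrees and yields \<open>q\<close>. Every other block agrees with
  probability \<open>1 / m\<close> and yields \<open>1 + (q - 1) / m\<close> on average.\<close>

lemma sum_agreements:
  fixes q :: real
  assumes "j < s" "k < m"
  defines "G \<equiv> {f \<in> block_choices s m. f j = k}"
  shows "(\<Sum>f\<in>G. \<Sum>g\<in>G. \<Prod>i<s. if f i = g i then q else 1) / (card G)\<^sup>2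
    = q * (1 + (q - 1) / m) ^ (s - 1)"
proof -
  have G: "G = (\<Pi>\<^sub>E i\<in>{..<s}. if i = j then {k} else {..<m})"
    unfolding G_def by (rule block_choices_fixed[OF assms(1,2)])
  have c: "real (card G) = real m ^ (s - 1)"
    unfolding G_def by (simp add: card_block_choices_fixed[OF assms(1,2)])
  have m: "real m > 0" using assms by simp
  have "(\<Sum>g\<in>G. \<Prod>i<s. if f i = g i then q else 1) = q * (real m - 1 + q) ^ (s - 1)"
    if f: "f \<in> G" for f
  proof -
    have "(\<Sum>g\<in>G. \<Prod>i<s. if f i = g i then q else 1)
        = (\<Prod>i<s. \<Sum>v\<in>(if i = j then {k} else {..<m}). if f i = v then q else 1)"
      unfolding G by (rule prod_sum_PiE[symmetric]) auto
    also have "\<dots> = (\<Prod>i<s. if i = j then q else real m - 1 + q)"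
    proof (intro prod.cong refl)
      fix i assume i: "i \<in> {..<s}"
      show "(\<Sum>v\<in>(if i = j then {k} else {..<m}). if f i = v then q else 1)
          = (if i = j then q else real m - 1 + q)"
      proof (cases "i = j")
        case True
        then show ?thesis using f by (simp add: G_def)
      next
        case False
        then have fi: "f i < m" using f i by (auto simp: G_def block_choices_def PiE_iff)
        have "(\<Sum>v<m. if f i = v then q else 1) = q + (\<Sum>v\<in>{..<m} - {f i}. 1)"
          using fi by (subst sum.remove[of _ "f i"]) (auto intro!: sum.cong)
        then show ?thesis using False fi by (simp add: of_nat_diff)
      qed
    qed
    also have "\<dots> = q * (real m - 1 + q) ^ (s - 1)"
      by (rule prod_if_eq_const[OF assms(1)])
    finally show ?thesis .
  qed
  then have "(\<Sum>f\<in>G. \<Sum>g\<in>G. \<Prod>i<s. if f i = g i then q else 1)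
      = real m ^ (s - 1) * (q * (real m - 1 + q) ^ (s - 1))"
    by (simp add: c)
  moreover have "real m - 1 + q = real m * (1 + (q - 1) / m)"
    using m by (simp add: field_simps)
  ultimately show ?thesis
    using m by (simp add: c power_mult_distrib power2_eq_square)
qed

section \<open>Variance and bias under the block mixtures\<close>

text \<open>The mixture is uniform over the configurations that activate position \<open>k\<close>
  of block \<open>j\<close>; each agreeing block contributes a factor
  \<open>q = exp (a\<^sup>2)\<close>.\<close>

lemma block_variance_bound:
  assumes sm: "s * m \<le> n" and j: "j < s" and k: "k < m"
    and T: "T \<in> borel_measurable (\<Pi>\<^sub>M i\<in>{1..n}. (borel :: real measure))"
    and T2: "integrable (gaussian_seq n (zero_vector n)) (\<lambda>x. (T x)\<^sup>2)"
  defines "G \<equiv> {f \<in> block_choices s m. f j = k}"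
  shows "((\<Sum>f\<in>G. integral\<^sup>L (gaussian_seq n (block_vector n s m a f)) T) / card G
        - integral\<^sup>L (gaussian_seq n (zero_vector n)) T)\<^sup>2
      \<le> prob_space.variance (gaussian_seq n (zero_vector n)) T
        * (exp (a\<^sup>2) * (1 + (exp (a\<^sup>2) - 1) / m) ^ (s - 1))"
proof -
  have c: "card G = m ^ (s - 1)"
    unfolding G_def by (rule card_block_choices_fixed[OF j k])
  have m: "m > 0" using k by simp
  with c have "card G > 0" by simp
  then have G: "finite G" "G \<noteq> {}" by (auto simp: card_gt_0_iff)
  have "(\<Sum>f\<in>G. \<Sum>g\<in>G. exp (\<Sum>i=1..n. block_vector n s m a f i * block_vector n s m a g i))
      = (\<Sum>f\<in>G. \<Sum>g\<in>G. \<Prod>i<s. if f i = g i then exp (a\<^sup>2) else 1)"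
  proof (intro sum.cong refl)
    fix f g assume "f \<in> G" "g \<in> G"
    then show "exp (\<Sum>i=1..n. block_vector n s m a f i * block_vector n s m a g i)
        = (\<Prod>i<s. if f i = g i then exp (a\<^sup>2) else 1)"
      unfolding G_def by (subst block_vector_inner[OF sm m]) (auto simp: exp_sum intro!: prod.cong)
  qed
  then show ?thesis
    using mixture_variance_bound[OF G T T2, of "block_vector n s m a"]
      sum_agreements[OF j k, of "exp (a\<^sup>2)", folded G_def] by (simp only:)
qed

text \<open>
  A coordinate of block \<open>j\<close> is active in a fraction \<open>1 / m\<close> of the supports only, so averaging
  over those supports inflates the bias bound by the factor \<open>m\<close>.
\<close>

lemma averaged_bias_bound:
  fixes b :: "(nat \<Rightarrow> nat) \<Rightarrow> nat \<Rightarrow> real"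
  assumes sm: "s * m \<le> n" and m: "m > 0"
    and b: "\<And>f. (\<Sum>i=1..n. (b f i)\<^sup>2) \<le> C"
  shows "(\<Sum>j<s. \<Sum>k<m. ((\<Sum>f\<in>{f \<in> block_choices s m. f j = k}. b f (block_index m j k)) / m ^ (s - 1))\<^sup>2)
    \<le> m * C"
\<comment> \<open>The closing quotient \<open>m ^ s / m ^ (s - 1) = m\<close> needs
  \<open>s > 0\<close>, since \<open>0 - 1 = 0\<close> on the naturals.\<close>
proof (cases "s = 0")
  case True
  have "0 \<le> C" by (rule order_trans[OF _ b]) (auto intro: sum_nonneg)
  with True show ?thesis by simp
next
  case False
  define F where "F = block_choices s m"
  have F: "finite F" "card F = m ^ s"
    unfolding F_def block_choices_def by (auto intro!: finite_PiE simp: card_PiE)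
  let ?N = "real m ^ (s - 1)"
  have N: "?N > 0" using m by simp
  have "(\<Sum>j<s. \<Sum>k<m. ((\<Sum>f\<in>{f \<in> F. f j = k}. b f (block_index m j k)) / ?N)\<^sup>2)
      \<le> (\<Sum>j<s. \<Sum>k<m. (\<Sum>f\<in>{f \<in> F. f j = k}. (b f (block_index m j k))\<^sup>2) / ?N)"
  proof (intro sum_mono)
    fix j k assume jk: "j \<in> {..<s}" "k \<in> {..<m}"
    let ?S = "\<Sum>f\<in>{f \<in> F. f j = k}. (b f (block_index m j k))\<^sup>2"
    \<comment> \<open>The square of an average is at most the average of the squares.\<close>
    have "(\<Sum>f\<in>{f \<in> F. f j = k}. b f (block_index m j k))\<^sup>2 \<le> ?S * ?N"
      using sum_squared_le_sum_of_squares[of "\<lambda>f. b f (block_index m j k)" "{f \<in> F. f j = k}"]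
        card_block_choices_fixed[of j s k m] jk by (simp add: F_def)
    then have "((\<Sum>f\<in>{f \<in> F. f j = k}. b f (block_index m j k)) / ?N)\<^sup>2 \<le> ?S * ?N / ?N\<^sup>2"
      unfolding power_divide by (intro divide_right_mono) auto
    also have "?S * ?N / ?N\<^sup>2 = ?S / ?N"
      using m by (simp add: power2_eq_square)
    finally show "((\<Sum>f\<in>{f \<in> F. f j = k}. b f (block_index m j k)) / ?N)\<^sup>2 \<le> ?S / ?N" .
  qed
  also have "\<dots> = (\<Sum>j<s. \<Sum>k<m. \<Sum>f\<in>{f \<in> F. f j = k}. (b f (block_index m j (f j)))\<^sup>2) / ?N"
  proof -
    have "(\<Sum>f\<in>{f \<in> F. f j = k}. (b f (block_index m j k))\<^sup>2)
        = (\<Sum>f\<in>{f \<in> F. f j = k}. (b f (block_index m j (f j)))\<^sup>2)" for j k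
      by (intro sum.cong refl) simp
    then show ?thesis by (simp only: sum_divide_distrib [symmetric])
  qed
  also have "\<dots> = (\<Sum>j<s. \<Sum>f\<in>F. (b f (block_index m j (f j)))\<^sup>2) / ?N"
  \<comment> \<open>Every \<open>f\<close> is counted for exactly one \<open>k\<close>, namely
    \<open>f j\<close>.\<close>
  proof (intro arg_cong2[where f = "(/)"] sum.cong refl)
    fix j assume "j \<in> {..<s}"
    then show "(\<Sum>k<m. \<Sum>f\<in>{f \<in> F. f j = k}. (b f (block_index m j (f j)))\<^sup>2)
        = (\<Sum>f\<in>F. (b f (block_index m j (f j)))\<^sup>2)"
      using F by (intro sum.group) (auto simp: F_def block_choices_def PiE_iff)
  qed
  also have "\<dots> = (\<Sum>f\<in>F. \<Sum>j<s. (b f (block_index m j (f j)))\<^sup>2) / ?N"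
    by (subst sum.swap) simp
  also have "\<dots> \<le> (\<Sum>f\<in>F. C) / ?N"
  proof (intro divide_right_mono sum_mono)
    fix f assume "f \<in> F"
    then have "f j < m" if "j < s" for j using that by (auto simp: F_def block_choices_def PiE_iff)
    then have "(\<Sum>j<s. (b f (block_index m j (f j)))\<^sup>2) \<le> (\<Sum>j<s. \<Sum>k<m. (b f (block_index m j k))\<^sup>2)"
      by (intro sum_mono member_le_sum) auto
    also have "\<dots> \<le> (\<Sum>i=1..n. (b f i)\<^sup>2)"
      by (rule sum_block_index_le[OF sm m]) simp
    finally show "(\<Sum>j<s. (b f (block_index m j (f j)))\<^sup>2) \<le> C" using b[of f] by simp
  qed simp
  also have "\<dots> = m * C"
    using False m by (cases s) (simp_all add: F)
  finally show ?thesis by (simp add: F_def)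
qed

lemma zero_vector_sparse: "zero_vector n \<in> sparse_vectors n s"
proof -
  have "{i \<in> {1..n}. zero_vector n i \<noteq> 0} = {}" by (auto simp: zero_vector_def)
  then show ?thesis
    unfolding sparse_vectors_def mem_Collect_eq by (simp only:) (simp add: zero_vector_def)
qed

text \<open>On each block coordinate \<open>a = d - B + z\<close>, where \<open>d\<close> is the
  mixture mean minus the null mean, \<open>B\<close> the bias averaged over the mixture, and
  \<open>z\<close> the bias at the null vector. Minkowski's inequality separates the three;
  \<open>d\<close> is controlled by the variance, the others by \<open>C\<close>.\<close>

lemma variance_sum_bound:
  fixes n s m :: nat and a C K :: real
  assumes sm: "s * m \<le> n" and m: "m > 0" and a: "a \<ge> 0"
    and T: "\<And>i. i \<in> {1..n} \<Longrightarrow> (\<lambda>x. T x i) \<in> borel_measurable (\<Pi>\<^sub>M i\<in>{1..n}. (borel :: real measure))"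
    and T2: "\<And>i. i \<in> {1..n} \<Longrightarrow> integrable (gaussian_seq n (zero_vector n)) (\<lambda>x. (T x i)\<^sup>2)"
    and bias: "\<And>\<theta>. \<theta> \<in> sparse_vectors n s \<Longrightarrow> (\<Sum>i=1..n. (mean_vector n \<theta> T i - \<theta> i)\<^sup>2) \<le> C"
    and K: "exp (a\<^sup>2) * (1 + (exp (a\<^sup>2) - 1) / m) ^ (s - 1) \<le> K"
    and V: "V = (\<Sum>i=1..n. prob_space.variance (gaussian_seq n (zero_vector n)) (\<lambda>x. T x i))"
  shows "sqrt (s * m) * a \<le> sqrt (V * K) + sqrt (m * C) + sqrt C"
proof -
  let ?P = "gaussian_seq n (zero_vector n)"
  let ?var = "\<lambda>i. prob_space.variance ?P (\<lambda>x. T x i)"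
  let ?G = "\<lambda>j k. {f \<in> block_choices s m. f j = k}"
  let ?N = "real m ^ (s - 1)"
  let ?p = "\<lambda>(j, k). block_index m j k"
  define \<theta> where "\<theta> = block_vector n s m a"
  define b where "b f i = (if i \<in> {1..n} then mean_vector n (\<theta> f) T i - \<theta> f i else 0)" for f i
  define d where "d = (\<lambda>(j, k). (\<Sum>f\<in>?G j k. mean_vector n (\<theta> f) T (block_index m j k)) / ?N
      - mean_vector n (zero_vector n) T (block_index m j k))"
  define B where "B = (\<lambda>(j, k). (\<Sum>f\<in>?G j k. b f (block_index m j k)) / ?N)"
  define z where "z i = mean_vector n (zero_vector n) T i" for i
  let ?S = "{..<s} \<times> {..<m}"
  have var: "?var i \<ge> 0" for i
    by simp
  have C: "(\<Sum>i=1..n. (z i)\<^sup>2) \<le> C"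
    using bias[OF zero_vector_sparse] by (simp add: zero_vector_def z_def)
  have in_n: "block_index m j k \<in> {1..n}" if "j < s" "k < m" for j k
    using block_index_in[OF sm that] .
  have a_eq: "a = d p + (- B p + z (?p p))" if p: "p \<in> ?S" for p
  proof -
    obtain j k where jk: "p = (j, k)" "j < s" "k < m" using p by auto
    \<comment> \<open>The coordinate is active in every configuration of \<open>?G j k\<close>, so
      its mean is the bias plus \<open>a\<close>.\<close>
    have "(\<Sum>f\<in>?G j k. mean_vector n (\<theta> f) T (block_index m j k))
        = (\<Sum>f\<in>?G j k. b f (block_index m j k) + a)"
      by (intro sum.cong refl)
        (use in_n[OF jk(2,3)] in \<open>auto simp: b_def \<theta>_def block_vector_block_index[OF sm jk(2,3)]\<close>)
    also have "\<dots> = (\<Sum>f\<in>?G j k. b f (block_index m j k)) + ?N * a"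
      by (simp add: sum.distrib card_block_choices_fixed[OF jk(2,3)])
    finally have "d p = B p + a - z (?p p)"
      unfolding d_def B_def z_def jk(1) using m by (simp add: add_divide_distrib)
    then show ?thesis by simp
  qed
  have "L2_set (\<lambda>_. a) ?S = L2_set (\<lambda>p. d p + (- B p + z (?p p))) ?S"
    using a_eq by (rule L2_set_cong[OF refl])
  also have "\<dots> \<le> L2_set d ?S + L2_set (\<lambda>p. - B p + z (?p p)) ?S"
    by (rule L2_set_triangle_ineq)
  also have "L2_set (\<lambda>p. - B p + z (?p p)) ?S \<le> L2_set (\<lambda>p. - B p) ?S + L2_set (\<lambda>p. z (?p p)) ?S"
    by (rule L2_set_triangle_ineq)
  also have "L2_set (\<lambda>p. - B p) ?S = L2_set B ?S" by (simp add: L2_set_def)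
  finally have "L2_set (\<lambda>_. a) ?S \<le> L2_set d ?S + (L2_set B ?S + L2_set (\<lambda>p. z (?p p)) ?S)"
    by simp
  moreover have "L2_set (\<lambda>_. a) ?S = sqrt (s * m) * a"
    using a by (simp add: L2_set_constant)
  moreover have "L2_set d ?S \<le> sqrt (V * K)"
    unfolding L2_set_def
  proof (intro real_sqrt_le_mono)
    have K0: "K \<ge> 0"
      by (rule order_trans[OF _ K]) (auto intro!: mult_nonneg_nonneg zero_le_power add_nonneg_nonneg divide_nonneg_nonneg)
    have "(\<Sum>p\<in>?S. (d p)\<^sup>2) \<le> (\<Sum>p\<in>?S. ?var (?p p) * K)"
    proof (intro sum_mono)
      fix p assume "p \<in> ?S"
      then obtain j k where jk: "p = (j, k)" "j < s" "k < m" by auto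
      let ?i = "block_index m j k"
      note i = in_n[OF jk(2,3)]
      have "(d p)\<^sup>2 \<le> ?var ?i * (exp (a\<^sup>2) * (1 + (exp (a\<^sup>2) - 1) / m) ^ (s - 1))"
        using block_variance_bound[OF sm jk(2,3) T[OF i] T2[OF i], of a] i
        by (simp add: d_def jk(1) mean_vector_def \<theta>_def card_block_choices_fixed[OF jk(2,3)])
      also have "\<dots> \<le> ?var ?i * K"
        by (intro mult_left_mono K var)
      finally show "(d p)\<^sup>2 \<le> ?var (?p p) * K" by (simp add: jk(1))
    qed
    also have "\<dots> = (\<Sum>j<s. \<Sum>k<m. ?var (block_index m j k)) * K"
      by (simp add: sum.cartesian_product sum_distrib_right split_def)
    also have "\<dots> \<le> V * K"
      unfolding V by (intro mult_right_mono K0 sum_block_index_le[OF sm m] var)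
    finally show "(\<Sum>p\<in>?S. (d p)\<^sup>2) \<le> V * K" .
  qed
  moreover have "L2_set B ?S \<le> sqrt (m * C)"
    unfolding L2_set_def
  proof (intro real_sqrt_le_mono)
    have "(\<Sum>i=1..n. (b f i)\<^sup>2) \<le> C" for f
      using bias[OF block_vector_sparse, of m a f] by (simp add: b_def \<theta>_def)
    from averaged_bias_bound[OF sm m this]
    show "(\<Sum>p\<in>?S. (B p)\<^sup>2) \<le> m * C"
      by (simp add: B_def sum.cartesian_product split_def)
  qed
  moreover have "L2_set (\<lambda>p. z (?p p)) ?S \<le> sqrt C"
    unfolding L2_set_def
  proof (intro real_sqrt_le_mono)
    have "(\<Sum>p\<in>?S. (z (?p p))\<^sup>2) = (\<Sum>j<s. \<Sum>k<m. (z (block_index m j k))\<^sup>2)"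
      by (simp add: sum.cartesian_product split_def)
    also have "\<dots> \<le> (\<Sum>i=1..n. (z i)\<^sup>2)"
      by (rule sum_block_index_le[OF sm m]) simp
    finally show "(\<Sum>p\<in>?S. (z (?p p))\<^sup>2) \<le> C" using C by simp
  qed
  ultimately show ?thesis by simp
qed

section \<open>Numerical estimates and the final bound\<close>

text \<open>Fewer than \<open>s\<close> coordinates are left over, and
  \<open>s \<le> s\<^sup>2 \<le> n / 4\<close>, so the blocks cover at least three quarters of all
  coordinates. The last bound says \<open>(s - 1) * r \<le> m\<close> for
  \<open>r = n / s\<^sup>2\<close>, which keeps the second moment of the mixture bounded.\<close>

lemma block_size_bounds:
  fixes n s :: nat
  assumes s: "0 < s" and n: "4 * s\<^sup>2 \<le> n"
  defines "m \<equiv> n div s"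
  shows "s * m \<le> n" "4 \<le> m" "3 * n \<le> 4 * (s * m)" "(s - 1) * n \<le> s\<^sup>2 * m"
proof -
  show "s * m \<le> n" by (simp add: m_def)
  have "4 * s \<le> m"
    unfolding m_def using n s by (simp add: less_eq_div_iff_mult_less_eq power2_eq_square)
  then show "4 \<le> m" using s by linarith
  have lt: "n < s * m + s"
    using s by (metis add.commute dividend_less_times_div m_def mult.commute mult_Suc_right)
  have "s \<le> s\<^sup>2" using s by (simp add: power2_eq_square)
  then show "3 * n \<le> 4 * (s * m)" using lt n by linarith
  \<comment> \<open>The integers avoid truncated subtraction. Inserting
    \<open>n - s + 1 \<le> s * m\<close> leaves the slack \<open>n - s\<^sup>2 + s\<close>, which is
    nonnegative.\<close>
  have "int ((s - 1) * n) \<le> int (s\<^sup>2 * m)"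
  proof -
    have "(int s - 1) * int n = int s * (int n - int s + 1) - (int n - int s * int s + int s)"
      by (simp add: algebra_simps)
    moreover have "int s * (int n - int s + 1) \<le> int s * (int s * int m)"
    proof (rule mult_left_mono)
      have "int n < int (s * m + s)" using lt by (subst of_nat_less_iff)
      then show "int n - int s + 1 \<le> int s * int m" by simp
    qed simp
    moreover have "int s * int s \<le> int n"
    proof -
      have "s * s \<le> n" using n by (simp add: power2_eq_square)
      then have "int (s * s) \<le> int n" by (subst of_nat_le_iff)
      then show ?thesis by simp
    qed
    ultimately have "(int s - 1) * int n \<le> int s * (int s * int m)" by linarith
    then show ?thesis using s by (simp add: of_nat_diff power2_eq_square mult.assoc)
  qed
  then show "(s - 1) * n \<le> s\<^sup>2 * m" by (subst (asm) of_nat_le_iff)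
qed

text \<open>The left side without the constant is the total bias, relative to
  \<open>sqrt (s * m)\<close>, and the right side is the signal \<open>a\<close>. The constant is
  sharp: \<open>sqrt (4 * g\<^sup>2 + 1) - 3 / 2 * g\<close> is minimal at
  \<open>g\<^sup>2 = 9 / 28\<close>, with value \<open>sqrt (7 / 16)\<close>.\<close>

lemma signal_minus_bias:
  fixes g :: real
  assumes "g \<ge> 0"
  shows "3 / 2 * g + sqrt (7 / 16) \<le> sqrt (4 * g\<^sup>2 + 1)"
proof (rule real_le_rsqrt)
  define h where "h = sqrt (7 / 16 :: real)"
  have h: "h\<^sup>2 = 7 / 16" by (simp add: h_def)
  have "4 * g\<^sup>2 + 1 - (3 / 2 * g + h)\<^sup>2 = (2 * h * g - 3 / 4)\<^sup>2 + (1 - 9 / 16 - h\<^sup>2) + (7 / 4 - 4 * h\<^sup>2) * g\<^sup>2"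
    by (simp add: power2_eq_square algebra_simps)
  also have "\<dots> \<ge> 0" by (simp add: h)
  finally show "(3 / 2 * g + sqrt (7 / 16))\<^sup>2 \<le> 4 * g\<^sup>2 + 1" by (simp add: h_def)
qed

text \<open>The factor \<open>21 / 64\<close> is \<open>3 / 4 * 7 / 16\<close>, from the coverage of
  the blocks and the squared signal after subtracting the bias. One factor \<open>exp 1\<close>
  comes from \<open>exp (a\<^sup>2)\<close>, the other from the blocks that may agree by
  chance.\<close>

lemma variance_lower_bound:
  fixes n s :: nat and \<gamma> :: real
  assumes s: "0 < s" and n: "4 * s\<^sup>2 \<le> n"
    and T: "\<And>i. i \<in> {1..n} \<Longrightarrow> (\<lambda>x. T x i) \<in> borel_measurable (\<Pi>\<^sub>M i\<in>{1..n}. (borel :: real measure))"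
    and T2: "\<And>i. i \<in> {1..n} \<Longrightarrow> integrable (gaussian_seq n (zero_vector n)) (\<lambda>x. (T x i)\<^sup>2)"
    and bias: "\<And>\<theta>. \<theta> \<in> sparse_vectors n s \<Longrightarrow>
      (\<Sum>i=1..n. (mean_vector n \<theta> T i - \<theta> i)\<^sup>2) \<le> \<gamma> * s * ln (n / (real s)\<^sup>2)"
    and \<gamma>: "4 * \<gamma> + 1 / ln (n / (real s)\<^sup>2) \<le> 1"
    and V: "V = (\<Sum>i=1..n. prob_space.variance (gaussian_seq n (zero_vector n)) (\<lambda>x. T x i))"
  shows "21 / (64 * (exp 1)\<^sup>2) * n * ((real s)\<^sup>2 / n) powr (4 * \<gamma>) \<le> V"
proof -
  define r where "r = n / (real s)\<^sup>2"
  define L where "L = ln r"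
  define m where "m = n div s"
  define C where "C = \<gamma> * s * L"
  define g where "g = sqrt (\<gamma> * L)"
  define a where "a = sqrt (4 * g\<^sup>2 + 1)"
  define q where "q = exp (a\<^sup>2)"
  note mb = block_size_bounds[OF s n, folded m_def]
  have m: "m > 0" using mb(2) by simp
  have s': "real s > 0" using s by simp
  have n4: "4 * (real s)\<^sup>2 \<le> real n"
    using n by (metis of_nat_le_iff of_nat_mult of_nat_numeral of_nat_power)
  have r4: "r \<ge> 4" using n4 s' by (simp add: r_def le_divide_eq)
  have L: "L > 0" using r4 by (simp add: L_def)
  \<comment> \<open>A sum of squares is bounded by \<open>C\<close>, which forces
    \<open>\<gamma> \<ge> 0\<close> and makes \<open>g\<close> a genuine square root.\<close>
  have C0: "C \<ge> 0"
    using order_trans[OF sum_nonneg bias[OF zero_vector_sparse]] by (simp add: C_def L_def r_def)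
  then have "\<gamma> \<ge> 0" using L s' by (simp add: C_def zero_le_mult_iff)
  then have g2: "g\<^sup>2 = \<gamma> * L" and g0: "g \<ge> 0" using L by (auto simp: g_def)
  have a2: "a\<^sup>2 = 4 * g\<^sup>2 + 1" and a0: "a \<ge> 0" by (auto simp: a_def)
  have q: "q = exp 1 * r powr (4 * \<gamma>)"
    using r4 by (simp add: q_def a2 g2 L_def powr_def exp_add mult_ac)
  \<comment> \<open>The condition on \<open>\<gamma>\<close> enters here: it gives
    \<open>a\<^sup>2 \<le> L\<close>, that is \<open>q \<le> r\<close>.\<close>
  have "a\<^sup>2 = (4 * \<gamma> + 1 / L) * L" using L by (simp add: a2 g2 field_simps)
  also have "\<dots> \<le> 1 * L" using \<gamma> L by (intro mult_right_mono) (auto simp: L_def r_def)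
  finally have "q \<le> exp L" by (simp add: q_def)
  then have q_le: "q \<le> r" using r4 by (simp add: L_def)
  have q1: "q \<ge> 1" by (simp add: q_def)
  have K: "exp (a\<^sup>2) * (1 + (exp (a\<^sup>2) - 1) / m) ^ (s - 1) \<le> q * exp 1"
  proof -
    \<comment> \<open>By \<open>1 + x \<le> exp x\<close> it suffices that
      \<open>(s - 1) * (q - 1) / m \<le> 1\<close>, which follows from \<open>q \<le> r\<close> and
      the last block size bound.\<close>
    have "(1 + (q - 1) / m) ^ (s - 1) \<le> exp ((q - 1) / m) ^ (s - 1)"
      using q1 m by (intro power_mono exp_ge_add_one_self) simp
    also have "\<dots> = exp ((s - 1) * ((q - 1) / m))" by (rule exp_of_nat_mult [symmetric])
    also have "\<dots> \<le> exp 1"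
    proof -
      have "real (s - 1) * (q - 1) \<le> real (s - 1) * r"
        using q_le by (intro mult_left_mono) auto
      also have "\<dots> = real ((s - 1) * n) / (real s)\<^sup>2" by (simp add: r_def)
      also have "\<dots> \<le> real (s\<^sup>2 * m) / (real s)\<^sup>2"
        using mb(4) by (intro divide_right_mono) (simp_all only: of_nat_le_iff zero_le_power2)
      also have "\<dots> = real m" using s' by simp
      finally have "(s - 1) * ((q - 1) / m) \<le> 1" using m by (simp add: field_simps)
      then show ?thesis by simp
    qed
    finally show ?thesis by (simp add: q_def)
  qed
  have "sqrt (s * m) * a \<le> sqrt (V * (q * exp 1)) + sqrt (m * C) + sqrt C"
    using variance_sum_bound[OF mb(1) m a0 T T2 _ K V, of C] bias by (simp add: C_def L_def r_def)
  moreover have mC: "sqrt (m * C) = sqrt (s * m) * g"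
    by (simp add: C_def g_def mult_ac flip: real_sqrt_mult)
  \<comment> \<open>Since \<open>m \<ge> 4\<close>, the null bias costs at most half of the averaged
    bias; together they give the factor \<open>3 / 2\<close>.\<close>
  moreover have "sqrt C \<le> sqrt (s * m) * g / 2"
  proof -
    have "4 * C \<le> m * C" using mb(2) C0 by (intro mult_right_mono) auto
    then have "sqrt (4 * C) \<le> sqrt (m * C)" by (rule real_sqrt_le_mono)
    then have "2 * sqrt C \<le> sqrt (m * C)" by (simp only: real_sqrt_mult real_sqrt_four)
    then show ?thesis unfolding mC by simp
  qed
  moreover have "sqrt (s * m) * (3 / 2 * g + sqrt (7 / 16)) \<le> sqrt (s * m) * a"
    unfolding a_def by (intro mult_left_mono signal_minus_bias g0) simp
  ultimately have "sqrt (s * m) * sqrt (7 / 16) \<le> sqrt (V * (q * exp 1))"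
    by (simp add: algebra_simps)
  then have "s * m * (7 / 16) \<le> V * (q * exp 1)"
    unfolding real_sqrt_mult[symmetric] by simp
  moreover have "3 * real n \<le> 4 * (s * m)"
    using mb(3) by (metis of_nat_le_iff of_nat_mult of_nat_numeral)
  ultimately have "21 / 64 * n \<le> V * (q * exp 1)" by simp
  also have "q * exp 1 = (exp 1)\<^sup>2 * r powr (4 * \<gamma>)"
    by (simp add: q power2_eq_square)
  finally have "21 / 64 * n / ((exp 1)\<^sup>2 * r powr (4 * \<gamma>)) \<le> V"
    using r4 by (simp add: divide_le_eq)
  moreover have "((real s)\<^sup>2 / n) powr (4 * \<gamma>) = 1 / r powr (4 * \<gamma>)"
  proof -
    have "(real s)\<^sup>2 / n = 1 / r" by (simp add: r_def)
    then show ?thesis using r4 by (simp add: powr_divide)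
  qed
  ultimately show ?thesis by simp
qed

theorem theorem6p3:
  shows "\<exists>N::nat. \<forall>n\<ge>N. \<forall>(s::nat) (\<gamma>::real) (T :: (nat \<Rightarrow> real) \<Rightarrow> nat \<Rightarrow> real).
    0 < s \<longrightarrow> real s \<le> sqrt (real n) / 2 \<longrightarrow>
    is_estimator n s T \<longrightarrow>
    4 * \<gamma> + 1 / ln (real n / (real s)\<^sup>2) \<le> 0.99 \<longrightarrow>
    (SUP \<theta>\<in>sparse_vectors n s. ereal ((L2_set (\<lambda>i. mean_vector n \<theta> T i - \<theta> i) {1..n})\<^sup>2))
      \<le> ereal (\<gamma> * real s * ln (real n / (real s)\<^sup>2)) \<longrightarrow>
    ereal ((1 - (1 / 2) powr 0.01) / (25 * exp 1 * ln (real n / (real s)\<^sup>2))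
        * real n * ((real s)\<^sup>2 / real n) powr (4 * \<gamma>))
      \<le> (\<Sum>i=1..n. ext_variance (gaussian_seq n (zero_vector n)) (\<lambda>x. T x i))"
\<comment> \<open>The bound in \<open>variance_lower_bound\<close> is nonasymptotic, so the
  threshold \<open>0\<close> serves.\<close>
proof (intro exI[of _ 0] allI impI)
  fix n s :: nat and \<gamma> :: real and T :: "(nat \<Rightarrow> real) \<Rightarrow> nat \<Rightarrow> real"
  assume s: "0 < s" and sn: "real s \<le> sqrt (real n) / 2" and est: "is_estimator n s T"
    and \<gamma>: "4 * \<gamma> + 1 / ln (real n / (real s)\<^sup>2) \<le> 0.99"
    and sup: "(SUP \<theta>\<in>sparse_vectors n s. ereal ((L2_set (\<lambda>i. mean_vector n \<theta> T i - \<theta> i) {1..n})\<^sup>2))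
      \<le> ereal (\<gamma> * real s * ln (real n / (real s)\<^sup>2))"
  let ?P = "gaussian_seq n (zero_vector n)"
  let ?L = "ln (real n / (real s)\<^sup>2)"
  let ?R = "((real s)\<^sup>2 / real n) powr (4 * \<gamma>)"
  have "(2 * real s)\<^sup>2 \<le> (sqrt (real n))\<^sup>2" using sn by (intro power_mono) auto
  then have n4: "4 * (real s)\<^sup>2 \<le> real n" by simp
  then have n: "4 * s\<^sup>2 \<le> n"
    by (metis of_nat_le_iff of_nat_mult of_nat_numeral of_nat_power)
  have T: "(\<lambda>x. T x i) \<in> borel_measurable (\<Pi>\<^sub>M i\<in>{1..n}. (borel :: real measure))" if "i \<in> {1..n}" for i
    using measurable_compose[OF _ measurable_component_singleton[OF that]] est
    unfolding is_estimator_def by blast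
  have bias: "(\<Sum>i=1..n. (mean_vector n \<theta> T i - \<theta> i)\<^sup>2) \<le> \<gamma> * s * ?L" if "\<theta> \<in> sparse_vectors n s" for \<theta>
  proof -
    have "ereal ((L2_set (\<lambda>i. mean_vector n \<theta> T i - \<theta> i) {1..n})\<^sup>2) \<le> ereal (\<gamma> * s * ?L)"
      by (rule order_trans[OF SUP_upper[OF that] sup])
    then show ?thesis by (simp add: L2_set_def sum_nonneg)
  qed
  show "ereal ((1 - (1 / 2) powr 0.01) / (25 * exp 1 * ?L) * real n * ?R)
      \<le> (\<Sum>i=1..n. ext_variance ?P (\<lambda>x. T x i))"
  proof (cases "\<forall>i\<in>{1..n}. integrable ?P (\<lambda>x. (T x i)\<^sup>2)")
    case False
    \<comment> \<open>One component that is not square integrable makes the whole sum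
      infinite.\<close>
    then have "(\<Sum>i=1..n. ext_variance ?P (\<lambda>x. T x i)) = \<infinity>"
      by (auto simp: sum_Pinfty ext_variance_def)
    then show ?thesis by simp
  next
    case True
    \<comment> \<open>As \<open>exp 1 \<le> 3 < 4\<close>, the logarithm is at least
      \<open>1\<close> and may be dropped from the denominator.\<close>
    have "4 \<le> real n / (real s)\<^sup>2" using n4 s by (simp add: le_divide_eq)
    then have "exp 1 \<le> real n / (real s)\<^sup>2" using exp_le by linarith
    then have L: "?L \<ge> 1" using ln_ge_iff[of "real n / (real s)\<^sup>2" 1] n4 s
      by (smt (verit) exp_gt_zero)
    have "(1 - (1 / 2) powr 0.01) / (25 * exp 1 * ?L) \<le> 1 / (25 * exp 1 * 1 :: real)"
      using L by (intro frac_le) auto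
    \<comment> \<open>This amounts to \<open>64 * exp 1 \<le> 525\<close>.\<close>
    also have "\<dots> \<le> 21 / (64 * (exp 1)\<^sup>2)"
      using exp_le by (simp add: field_simps power2_eq_square)
    finally have "(1 - (1 / 2) powr 0.01) / (25 * exp 1 * ?L) * real n * ?R
        \<le> 21 / (64 * (exp 1)\<^sup>2) * n * ?R"
      by (intro mult_right_mono) auto
    also have "\<dots> \<le> (\<Sum>i=1..n. prob_space.variance ?P (\<lambda>x. T x i))"
    proof (rule variance_lower_bound[OF s n T _ bias _ refl])
      show "4 * \<gamma> + 1 / ?L \<le> 1" using \<gamma> by simp
    qed (use True in blast)+
    finally show ?thesis using True by (simp add: ext_variance_def)
  qed
qed

end
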